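(* Let $\mu\preceq_{\mathrm{st}}\nu$ be Borel probability measures on $\mathbb{R}$ and let $\phi:\mathbb{R}\to\mathbb{R}$ be a strictly increasing function. Then $$P_*(\mu,\nu)=P_*(\mu\circ\phi^{-1},\nu\circ\phi^{-1})\circ(\phi,\phi),$$ i.e. $P_*(\mu,\nu)(A)=P_*(\mu\circ\phi^{-1},\nu\circ\phi^{-1})\big(\{(\phi(x),\phi(y)):(x,y)\in A\}\big)$ for all Borel $A\subseteq\mathbb{R}^2$.
   Context: For finite Borel measures $\theta_1,\theta_2$ on $\mathbb{R}$ with cdf's $F_{\theta_i}(t)=\theta_i((-\infty,t])$, $\theta_1\preceq_{\mathrm{st}}\theta_2$ means $\theta_1(\mathbb{R})=\theta_2(\mathbb{R})$ and $F_{\theta_1}\ge F_{\theta_2}$; $\theta_1\le\theta_2$ means $\theta_1(A)\le\theta_2(A)$ for all Borel $A$. A directional coupling of $\mu,\nu$ is a probability measure on $\mathbb{R}^2$ with first marginal $\mu$ and second marginal $\nu$ concentrated on $\mathbb{H}=\{(x,y):y\ge x\}$. $P_*(\mu,\nu)$ denotes the optimal directional coupling: the unique directional coupling $P$ of $\mu,\nu$ such that $P((x,\infty)\times\cdot)=\nu_x$ for all $x\in\mathbb{R}$, where $\nu_x$ is the unique minimal element for $\preceq_{\mathrm{st}}$ of $\{\theta:\mu|_{(x,\infty)}\preceq_{\mathrm{st}}\theta\le\nu\}$ (equivalently, $F_{\nu_x}$ is the supremum of $F_\theta$ over this set). Existence and uniqueness hold whenever $\mu\preceq_{\mathrm{st}}\nu$.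 $\mu\circ\phi^{-1}$ is the pushforward of $\mu$ under $\phi$. *)

theory Defs
  imports "HOL-Probability.Probability"
begin

(* Finite Borel measures on the reals are the library locale finite_borel_measure, Borel
   probability measures on the reals are real_distribution, and cdf is the library's
   distribution function t |-> measure M {..t}. *)

definition st_le :: "real measure \<Rightarrow> real measure \<Rightarrow> bool"  (infix "\<preceq>\<^sub>s\<^sub>t" 50)
  where "\<theta>1 \<preceq>\<^sub>s\<^sub>t \<theta>2 \<longleftrightarrow>
    emeasure \<theta>1 UNIV = emeasure \<theta>2 UNIV \<and> (\<forall>t. cdf \<theta>1 t \<ge> cdf \<theta>2 t)"

definition directional_coupling :: "real measure \<Rightarrow> real measure \<Rightarrow> (real \<times> real) measure \<Rightarrow> bool"
  where "directional_coupling \<mu> \<nu> P \<longleftrightarrow>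
    prob_space P \<and> sets P = sets borel \<and>
    distr P borel fst = \<mu> \<and> distr P borel snd = \<nu> \<and>
    (AE (x, y) in P. y \<ge> x)"

(* The restriction of \<mu> to (x, \<infinity>) has to stay a measure on the whole line,
   hence density by an indicator rather than restrict_space. *)
definition target_candidates :: "real measure \<Rightarrow> real measure \<Rightarrow> real \<Rightarrow> real measure set"
  where "target_candidates \<mu> \<nu> x =
    {\<theta>. finite_borel_measure \<theta> \<and> density \<mu> (indicator {x<..}) \<preceq>\<^sub>s\<^sub>t \<theta> \<and>
        (\<forall>A\<in>sets borel. emeasure \<theta> A \<le> emeasure \<nu> A)}"

(* The measure \<nu>_x. *)
definition minimal_target :: "real measure \<Rightarrow> real measure \<Rightarrow> real \<Rightarrow> real measure"
  where "minimal_target \<mu> \<nu> x =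
    (THE \<theta>. \<theta> \<in> target_candidates \<mu> \<nu> x \<and>
       (\<forall>\<theta>'\<in>target_candidates \<mu> \<nu> x. \<theta>' \<preceq>\<^sub>s\<^sub>t \<theta> \<longrightarrow> \<theta>' = \<theta>))"

definition optimal_directional_coupling :: "real measure \<Rightarrow> real measure \<Rightarrow> (real \<times> real) measure"
    ("P\<^sub>*")
  where "P\<^sub>* \<mu> \<nu> =
    (THE P. directional_coupling \<mu> \<nu> P \<and>
       (\<forall>x. \<forall>B\<in>sets borel.
          emeasure P ({x<..} \<times> B) = emeasure (minimal_target \<mu> \<nu> x) B))"

end

theory Submission
  imports Defs
begin

text \<open>
  For a finite measure \<open>\<kappa>\<close>, consider its targets: the measures \<open>\<theta> \<le> \<nu>\<close> with \<open>\<kappa> \<preceq>\<^sub>s\<^sub>t \<theta>\<close>.  The optimal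
  coupling is built from the least targets of the restrictions of \<open>\<mu>\<close> to open rays, and the theorem
  holds because a strictly increasing \<open>\<phi>\<close> carries the whole construction along.

  \<^bold>\<open>Invariance.\<close>  Pushing forward along \<open>\<phi>\<close> preserves the stochastic order.  Every measure below the image
  of \<open>\<nu>\<close> is concentrated on the range of \<open>\<phi>\<close>, so it is in turn the image of a measure below \<open>\<nu>\<close>.  Hence
  least targets are mapped to least targets (\<open>least_target_distr\<close>).  The restriction of the image
  of \<open>\<mu>\<close> to \<open>{x<..}\<close> is the image of the restriction of \<open>\<mu>\<close> to an upward closed set, which need not be an
  open ray since \<open>\<phi>\<close> may jump; a comparison of masses extends the defining property of the
  coupling from open rays to all upward closed sets (\<open>upper_slices_upward_closed\<close>).  Thus the image of
  an optimal coupling is optimal for the image measures (\<open>is_optimal_coupling_distr\<close>), and it is the only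
  one, as its values on the rectangles \<open>{x<..} \<times> B\<close> are prescribed (\<open>measure_eqI_upper_slices\<close>).

  \<^bold>\<open>Existence.\<close>  Both sides of the equation are definite descriptions, so an optimal coupling of \<open>\<mu>\<close>
  and \<open>\<nu>\<close> has to be constructed.  The least target of \<open>\<kappa>\<close> is explicit: its distribution function is
  that of \<open>\<nu>\<close> minus the running maximum of the positive part of \<open>cdf \<nu> - cdf \<kappa>\<close>.  It increases, as
  a measure, with \<open>\<kappa>\<close> (\<open>earliest_target_mono\<close>).  The least targets of the restrictions of \<open>\<mu>\<close>
  to the rays \<open>{x<..}\<close> therefore form a decreasing family of measures below \<open>\<nu>\<close>.  Their densities with
  respect to \<open>\<nu>\<close> are the conditional probabilities that the first coordinate exceeds \<open>x\<close>, given the second,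
  and one independent uniform variable realises all of them at once
  (\<open>ex_measure_with_upper_slices\<close>).
\<close>

section \<open>Setwise domination and distribution functions\<close>

lemma finite_borel_measure_le_iff:
  assumes "finite_borel_measure M" "finite_borel_measure N"
  shows "M \<le> N \<longleftrightarrow> (\<forall>A\<in>sets borel. measure M A \<le> measure N A)"
proof -
  interpret M: finite_borel_measure M by fact
  interpret N: finite_borel_measure N by fact
  show ?thesis
    by (simp add: le_measure M.M_is_borel N.M_is_borel M.emeasure_eq_measure N.emeasure_eq_measure)
qed

lemma cdf_diff_mono_if_le:
  assumes M: "finite_borel_measure M" and N: "finite_borel_measure N" and "M \<le> N" "s \<le> t"
  shows "cdf M t - cdf M s \<le> cdf N t - cdf N s"
proof (cases "s = t")
  case False
  then have "s < t" using \<open>s \<le> t\<close> by simp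
  moreover have "measure M {s<..t} \<le> measure N {s<..t}"
    using assms finite_borel_measure_le_iff[OF M N] by simp
  ultimately show ?thesis
    using finite_borel_measure.cdf_diff_eq[OF M] finite_borel_measure.cdf_diff_eq[OF N] by simp
qed simp

text \<open>
  The increments of \<open>cdf N - cdf M\<close> are the masses of half-open intervals under a third measure
  \<open>R\<close>.  The identity \<open>M + R = N\<close>, unlike the inequality itself, passes from half-lines to all
  Borel sets by the usual monotone-class argument.
\<close>

lemma le_if_cdf_diff_mono:
  assumes M: "finite_borel_measure M" and N: "finite_borel_measure N"
    and mono: "\<And>s t. s \<le> t \<Longrightarrow> cdf M t - cdf M s \<le> cdf N t - cdf N s"
  shows "M \<le> N"
proof -
  interpret M: finite_borel_measure M by fact
  interpret N: finite_borel_measure N by fact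
  define H where "H t = cdf N t - cdf M t" for t
  define R where "R = interval_measure H"
  have H_mono: "x \<le> y \<Longrightarrow> H x \<le> H y" for x y
    using mono[of x y] by (simp add: H_def)
  have H_cont: "continuous (at_right a) H" for a
    unfolding H_def[abs_def] by (intro continuous_diff N.cdf_is_right_cont M.cdf_is_right_cont)
  have H_bot: "(H \<longlongrightarrow> 0) at_bot"
    using tendsto_diff[OF N.cdf_lim_at_bot M.cdf_lim_at_bot] by (simp add: H_def[abs_def])
  define m where "m = measure N (space N) - measure M (space M)"
  have H_top: "(H \<longlongrightarrow> m) at_top"
    using tendsto_diff[OF N.cdf_lim_at_top M.cdf_lim_at_top] by (simp add: H_def[abs_def] m_def)
  have "0 \<le> H x" for x
    using H_bot by (rule tendsto_upperbound)
      (auto simp: eventually_at_bot_linorder intro!: exI[of _ x] H_mono)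
  then have "0 \<le> m"
    by (intro tendsto_lowerbound[OF H_top]) auto
  then have R_UNIV: "emeasure R UNIV = m" and R_fin: "finite_borel_measure R"
    unfolding R_def
    using interval_measure_UNIV[OF H_mono H_cont H_bot H_top]
      finite_borel_measure_interval_measure[OF H_mono H_cont H_bot H_top] by auto
  interpret R: finite_borel_measure R by fact
  have R_cdf: "cdf R = H"
    unfolding R_def by (rule cdf_interval_measure[OF H_mono H_cont H_bot])
  note [simp] = M.M_is_borel N.M_is_borel R.M_is_borel M.borel_UNIV N.borel_UNIV R.borel_UNIV
  have R_mass: "measure R UNIV = measure N UNIV - measure M UNIV"
    using R_UNIV \<open>0 \<le> m\<close> by (simp add: measure_def m_def)
  have sum: "measure M A + measure R A = measure N A" if "A \<in> sets borel" for A
  proof -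
    have "Int_stable (range (\<lambda>a::real. {..a}))"
      by (auto simp: Int_stable_def)
    moreover have "range (\<lambda>a::real. {..a}) \<subseteq> Pow UNIV" by simp
    moreover have "A \<in> sigma_sets UNIV (range (\<lambda>a::real. {..a}))"
      using that by (subst (asm) borel_eq_atMost) simp
    ultimately show ?thesis
    proof (induction rule: sigma_sets_induct_disjoint)
      case (basic A)
      then obtain a where "A = {..a}" by auto
      then show ?case using fun_cong[OF R_cdf, of a] by (simp add: cdf_def H_def)
    next
      case (compl A)
      then have "A \<in> sets borel" by (subst borel_eq_atMost) simp
      then show ?case
        using compl M.finite_measure_compl[of A] N.finite_measure_compl[of A]
          R.finite_measure_compl[of A] R_mass by simp
    next
      case (union A)
      have A: "range A \<subseteq> sets borel" using union by (subst borel_eq_atMost) simp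
      have "(\<lambda>i. measure M (A i) + measure R (A i)) sums
          (measure M (\<Union>i. A i) + measure R (\<Union>i. A i))"
        using A union by (intro sums_add M.finite_measure_UNION R.finite_measure_UNION) auto
      moreover have "(\<lambda>i. measure N (A i)) sums measure N (\<Union>i. A i)"
        using A union by (intro N.finite_measure_UNION) auto
      ultimately show ?case using union by (simp add: sums_unique2)
    qed simp
  qed
  show ?thesis
    unfolding finite_borel_measure_le_iff[OF M N]
    using sum by (metis le_add_same_cancel1 measure_nonneg)
qed

section \<open>The earliest target of a measure\<close>

definition st_targets :: "real measure \<Rightarrow> real measure \<Rightarrow> real measure set"
  where "st_targets \<kappa> \<nu> = {\<theta>. finite_borel_measure \<theta> \<and> \<kappa> \<preceq>\<^sub>s\<^sub>t \<theta> \<and> \<theta> \<le> \<nu>}"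

text \<open>
  The mass of \<open>\<nu>\<close> that every target of \<open>\<kappa>\<close> has to leave unused on \<open>{..t}\<close>: a target below \<open>\<nu>\<close>
  that starts no earlier than \<open>\<kappa>\<close> misses at least \<open>cdf \<nu> s - cdf \<kappa> s\<close> of \<open>\<nu>\<close> on each half-line
  \<open>{..s}\<close>, and what is missed on \<open>{..s}\<close> is missed on \<open>{..t}\<close>.  The truncation at \<open>0\<close> stands for
  the half-line at \<open>s = -\<infinity>\<close>.
\<close>

definition excess :: "real measure \<Rightarrow> real measure \<Rightarrow> real \<Rightarrow> real"
  where "excess \<kappa> \<nu> t = (SUP s\<in>{..t}. max 0 (cdf \<nu> s - cdf \<kappa> s))"

definition earliest_target :: "real measure \<Rightarrow> real measure \<Rightarrow> real measure"
  where "earliest_target \<kappa> \<nu> = interval_measure (\<lambda>t. cdf \<nu> t - excess \<kappa> \<nu> t)"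

context
  fixes \<kappa> \<nu> :: "real measure"
  assumes K: "finite_borel_measure \<kappa>" and N: "finite_borel_measure \<nu>"
begin

interpretation K: finite_borel_measure \<kappa> by (rule K)
interpretation N: finite_borel_measure \<nu> by (rule N)

lemma excess_ge:
  assumes "s \<le> t" shows "max 0 (cdf \<nu> s - cdf \<kappa> s) \<le> excess \<kappa> \<nu> t"
  unfolding excess_def
proof (rule cSUP_upper)
  show "bdd_above ((\<lambda>s. max 0 (cdf \<nu> s - cdf \<kappa> s)) ` {..t})"
  proof (rule bdd_aboveI2)
    fix s show "max 0 (cdf \<nu> s - cdf \<kappa> s) \<le> measure \<nu> (space \<nu>)"
      using N.cdf_bounded[of s] K.cdf_nonneg[of s] by (simp add: measure_nonneg)
  qed
qed (use assms in simp)

lemma excess_nonneg: "0 \<le> excess \<kappa> \<nu> t"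
  using excess_ge[of t t] by simp

lemma excess_ge_diff: "s \<le> t \<Longrightarrow> cdf \<nu> s - cdf \<kappa> s \<le> excess \<kappa> \<nu> t"
  using excess_ge[of s t] by simp

lemma excess_le:
  assumes "0 \<le> c" "\<And>s. s \<le> t \<Longrightarrow> cdf \<nu> s - cdf \<kappa> s \<le> c"
  shows "excess \<kappa> \<nu> t \<le> c"
  unfolding excess_def using assms by (intro cSUP_least) auto

lemma excess_mono: "s \<le> t \<Longrightarrow> excess \<kappa> \<nu> s \<le> excess \<kappa> \<nu> t"
  by (rule excess_le[OF excess_nonneg]) (auto intro: excess_ge_diff)

text \<open>
  For \<open>s < r \<le> t\<close> the value of \<open>cdf \<nu> - cdf \<kappa>\<close> at \<open>r\<close> exceeds that at \<open>s\<close> by at most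
  \<open>cdf \<nu> t - cdf \<nu> s\<close>, because \<open>cdf \<kappa>\<close> does not decrease.  This single bound gives both the monotonicity
  of \<open>cdf \<nu> - excess \<kappa> \<nu>\<close> and the right continuity of the excess.
\<close>

lemma excess_increment:
  assumes "s \<le> t"
  shows "excess \<kappa> \<nu> t - excess \<kappa> \<nu> s \<le> cdf \<nu> t - cdf \<nu> s"
proof -
  have "excess \<kappa> \<nu> t \<le> excess \<kappa> \<nu> s + (cdf \<nu> t - cdf \<nu> s)"
  proof (rule excess_le)
    show "0 \<le> excess \<kappa> \<nu> s + (cdf \<nu> t - cdf \<nu> s)"
      using excess_nonneg[of s] N.cdf_nondecreasing[OF assms] by simp
    fix r assume "r \<le> t"
    show "cdf \<nu> r - cdf \<kappa> r \<le> excess \<kappa> \<nu> s + (cdf \<nu> t - cdf \<nu> s)"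
    proof (cases "r \<le> s")
      case True
      then show ?thesis
        using excess_ge_diff[of r s] N.cdf_nondecreasing[OF assms] by simp
    next
      case False
      then show ?thesis
        using excess_ge_diff[of s s] N.cdf_nondecreasing[OF \<open>r \<le> t\<close>] K.cdf_nondecreasing[of s r]
        by simp
    qed
  qed
  then show ?thesis by simp
qed

lemma excess_right_cont: "continuous (at_right a) (excess \<kappa> \<nu>)"
  unfolding continuous_within
proof (rule tendsto_sandwich)
  show "\<forall>\<^sub>F t in at_right a. excess \<kappa> \<nu> a \<le> excess \<kappa> \<nu> t"
    by (auto simp: eventually_at_filter intro!: always_eventually excess_mono)
  show "\<forall>\<^sub>F t in at_right a. excess \<kappa> \<nu> t \<le> excess \<kappa> \<nu> a + (cdf \<nu> t - cdf \<nu> a)"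
    using eventually_at_right_less[of a]
    by eventually_elim (use excess_increment[of a] in \<open>simp add: algebra_simps\<close>)
  have "(cdf \<nu> \<longlongrightarrow> cdf \<nu> a) (at_right a)"
    using N.cdf_is_right_cont[of a] by (simp add: continuous_within)
  then have "((\<lambda>t. excess \<kappa> \<nu> a + (cdf \<nu> t - cdf \<nu> a)) \<longlongrightarrow> excess \<kappa> \<nu> a + (cdf \<nu> a - cdf \<nu> a)) (at_right a)"
    by (intro tendsto_intros)
  then show "((\<lambda>t. excess \<kappa> \<nu> a + (cdf \<nu> t - cdf \<nu> a)) \<longlongrightarrow> excess \<kappa> \<nu> a) (at_right a)"
    by simp
qed simp

lemma cdf_target_le:
  assumes "\<theta> \<in> st_targets \<kappa> \<nu>"
  shows "cdf \<theta> t \<le> cdf \<nu> t - excess \<kappa> \<nu> t"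
proof -
  have T: "finite_borel_measure \<theta>" and le: "\<theta> \<le> \<nu>" and st: "\<And>s. cdf \<theta> s \<le> cdf \<kappa> s"
    using assms by (auto simp: st_targets_def st_le_def)
  have "excess \<kappa> \<nu> t \<le> cdf \<nu> t - cdf \<theta> t"
  proof (rule excess_le)
    show "0 \<le> cdf \<nu> t - cdf \<theta> t"
      using finite_borel_measure_le_iff[OF T N] le by (simp add: cdf_def)
    fix s assume "s \<le> t"
    show "cdf \<nu> s - cdf \<kappa> s \<le> cdf \<nu> t - cdf \<theta> t"
      using cdf_diff_mono_if_le[OF T N le \<open>s \<le> t\<close>] st[of s] by simp
  qed
  then show ?thesis by simp
qed

context
  assumes tails: "\<And>s. measure \<kappa> {s<..} \<le> measure \<nu> {s<..}"
begin

text \<open>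
  The tail condition bounds the excess by the mass that \<open>\<nu>\<close> has beyond \<open>\<kappa>\<close>, so exactly the mass
  of \<open>\<kappa>\<close> survives in the limit at \<open>\<infinity>\<close>.
\<close>

lemma
  shows finite_borel_measure_earliest_target: "finite_borel_measure (earliest_target \<kappa> \<nu>)"
    and cdf_earliest_target: "cdf (earliest_target \<kappa> \<nu>) t = cdf \<nu> t - excess \<kappa> \<nu> t"
    and emeasure_earliest_target_UNIV: "emeasure (earliest_target \<kappa> \<nu>) UNIV = emeasure \<kappa> UNIV"
proof -
  let ?F = "\<lambda>t. cdf \<nu> t - excess \<kappa> \<nu> t"
  define c where "c = measure \<nu> UNIV - measure \<kappa> UNIV"
  note [simp] = K.M_is_borel N.M_is_borel K.borel_UNIV N.borel_UNIV
  have tail_eq: "measure M {s<..} = measure M UNIV - cdf M s" if "finite_borel_measure M" for M s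
  proof -
    interpret M: finite_borel_measure M by fact
    have "UNIV - {..s} = {s<..}" by auto
    then show ?thesis
      using M.finite_measure_compl[of "{..s}"] by (simp add: cdf_def M.M_is_borel M.borel_UNIV)
  qed
  have diff_le: "cdf \<nu> s - cdf \<kappa> s \<le> c" for s
    using tails[of s] by (simp add: tail_eq K N c_def)
  have "((\<lambda>s. cdf \<nu> s - cdf \<kappa> s) \<longlongrightarrow> 0 - 0) at_bot"
    by (intro tendsto_diff K.cdf_lim_at_bot N.cdf_lim_at_bot)
  then have "0 - 0 \<le> c"
    by (rule tendsto_upperbound) (auto intro!: always_eventually diff_le)
  then have excess_le_c: "excess \<kappa> \<nu> t \<le> c" for t
    by (intro excess_le diff_le) auto
  have mono: "s \<le> t \<Longrightarrow> ?F s \<le> ?F t" for s t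
    using excess_increment[of s t] by simp
  have cont: "continuous (at_right a) ?F" for a
    by (intro continuous_diff N.cdf_is_right_cont excess_right_cont)
  have F_nonneg: "0 \<le> ?F t" for t
    using excess_le[of "cdf \<nu> t" t] N.cdf_nonneg K.cdf_nonneg N.cdf_nondecreasing
    by (smt (verit, best))
  have bot: "(?F \<longlongrightarrow> 0) at_bot"
    by (rule tendsto_sandwich[OF _ _ tendsto_const N.cdf_lim_at_bot])
      (auto simp: excess_nonneg intro!: always_eventually F_nonneg[simplified])
  have top: "(?F \<longlongrightarrow> measure \<kappa> UNIV) at_top"
  proof (rule tendsto_sandwich)
    show "\<forall>\<^sub>F t in at_top. cdf \<nu> t - c \<le> ?F t"
      using excess_le_c by simp
    show "\<forall>\<^sub>F t in at_top. ?F t \<le> cdf \<kappa> t"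
      using excess_ge_diff[OF order_refl] by (auto intro!: always_eventually simp: algebra_simps)
    show "((\<lambda>t. cdf \<nu> t - c) \<longlongrightarrow> measure \<kappa> UNIV) at_top"
      using tendsto_diff[OF N.cdf_lim_at_top tendsto_const[of c]] by (simp add: c_def)
    show "(cdf \<kappa> \<longlongrightarrow> measure \<kappa> UNIV) at_top"
      using K.cdf_lim_at_top by simp
  qed
  show "finite_borel_measure (earliest_target \<kappa> \<nu>)"
    unfolding earliest_target_def
    by (rule finite_borel_measure_interval_measure[OF mono cont bot top]) (simp_all add: measure_nonneg)
  show "cdf (earliest_target \<kappa> \<nu>) t = ?F t"
    unfolding earliest_target_def using cdf_interval_measure[OF mono cont bot] by (simp add: fun_eq_iff)
  show "emeasure (earliest_target \<kappa> \<nu>) UNIV = emeasure \<kappa> UNIV"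
    unfolding earliest_target_def
    using interval_measure_UNIV[OF mono cont bot top] by (simp add: measure_nonneg K.emeasure_eq_measure)
qed

lemma earliest_target_le: "earliest_target \<kappa> \<nu> \<le> \<nu>"
  using excess_mono
  by (intro le_if_cdf_diff_mono finite_borel_measure_earliest_target N)
    (simp add: cdf_earliest_target)

lemma st_le_earliest_target: "\<kappa> \<preceq>\<^sub>s\<^sub>t earliest_target \<kappa> \<nu>"
  using excess_ge_diff[OF order_refl]
  by (auto simp: st_le_def cdf_earliest_target emeasure_earliest_target_UNIV algebra_simps)

lemma earliest_target_least:
  assumes "\<theta> \<in> st_targets \<kappa> \<nu>" shows "earliest_target \<kappa> \<nu> \<preceq>\<^sub>s\<^sub>t \<theta>"
  using assms cdf_target_le[OF assms]
  by (auto simp: st_le_def cdf_earliest_target emeasure_earliest_target_UNIV st_targets_def)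

end

end

text \<open>
  If \<open>\<kappa>\<close> grows by a measure with distribution function \<open>k\<close>, the function whose running maximum is the
  excess drops by the nondecreasing \<open>k\<close>.  When the running maximum of the lowered function reaches a
  new record at \<open>r > s\<close>, the original one has there a value larger by \<open>k r\<close>, while its record up to
  \<open>s\<close> was larger by at most \<open>k s \<le> k r\<close>.  So lowering by \<open>k\<close> only shrinks the increments of the excess,
  and the earliest target gains mass on every interval.
\<close>

lemma earliest_target_mono:
  assumes K: "finite_borel_measure \<kappa>" and K': "finite_borel_measure \<kappa>'"
    and N: "finite_borel_measure \<nu>"
    and le: "\<kappa> \<le> \<kappa>'" and tails: "\<And>s. measure \<kappa>' {s<..} \<le> measure \<nu> {s<..}"
  shows "earliest_target \<kappa> \<nu> \<le> earliest_target \<kappa>' \<nu>"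
proof -
  have le': "measure \<kappa> A \<le> measure \<kappa>' A" if "A \<in> sets borel" for A
    using le that finite_borel_measure_le_iff[OF K K'] by blast
  have tails0: "measure \<kappa> {s<..} \<le> measure \<nu> {s<..}" for s
    using le'[of "{s<..}"] tails[of s] by simp
  let ?D = "excess \<kappa> \<nu>" and ?D' = "excess \<kappa>' \<nu>"
  have k_mono: "cdf \<kappa>' s - cdf \<kappa> s \<le> cdf \<kappa>' t - cdf \<kappa> t" if "s \<le> t" for s t
    using cdf_diff_mono_if_le[OF K K' le that] by simp
  have k_nonneg: "0 \<le> cdf \<kappa>' s - cdf \<kappa> s" for s
    using le'[of "{..s}"] by (simp add: cdf_def)
  have D_le: "?D t \<le> ?D' t + (cdf \<kappa>' t - cdf \<kappa> t)" for t
  proof (rule excess_le[OF K N])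
    show "0 \<le> ?D' t + (cdf \<kappa>' t - cdf \<kappa> t)"
      using excess_nonneg[OF K' N, of t] k_nonneg[of t] by simp
    fix s assume "s \<le> t"
    then show "cdf \<nu> s - cdf \<kappa> s \<le> ?D' t + (cdf \<kappa>' t - cdf \<kappa> t)"
      using excess_ge_diff[OF K' N, of s t] k_mono[of s t] by simp
  qed
  have incr: "?D' t - ?D' s \<le> ?D t - ?D s" if "s \<le> t" for s t
  proof -
    have "?D' t \<le> ?D' s + (?D t - ?D s)"
    proof (rule excess_le[OF K' N])
      show "0 \<le> ?D' s + (?D t - ?D s)"
        using excess_nonneg[OF K' N, of s] excess_mono[OF K N \<open>s \<le> t\<close>] by simp
      fix r assume "r \<le> t"
      show "cdf \<nu> r - cdf \<kappa>' r \<le> ?D' s + (?D t - ?D s)"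
      proof (cases "r \<le> s")
        case True
        then show ?thesis
          using excess_ge_diff[OF K' N True] excess_mono[OF K N \<open>s \<le> t\<close>] by simp
      next
        case False
        then show ?thesis
          using excess_ge_diff[OF K N \<open>r \<le> t\<close>] D_le[of s] k_mono[of s r] by simp
      qed
    qed
    then show ?thesis by simp
  qed
  show ?thesis
    using incr
    by (intro le_if_cdf_diff_mono finite_borel_measure_earliest_target K K' N tails tails0)
      (simp add: cdf_earliest_target K K' N tails tails0 algebra_simps)
qed

section \<open>Couplings with prescribed upper slices\<close>

text \<open>
  Integrating \<open>f - g\<close> over the set where it is positive gives a nonpositive number; finiteness allows the
  subtraction.
\<close>

lemma AE_le_if_density_le:
  assumes [measurable]: "f \<in> borel_measurable M" "g \<in> borel_measurable M"
    and le: "density M f \<le> density M g" and fin: "finite_measure (density M g)"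
  shows "AE x in M. f x \<le> g x"
proof -
  define A where "A = {x\<in>space M. g x < f x}"
  have [measurable]: "A \<in> sets M" unfolding A_def by measurable
  have fA: "emeasure (density M f) A = (\<integral>\<^sup>+x. f x * indicator A x \<partial>M)"
    and gA: "emeasure (density M g) A = (\<integral>\<^sup>+x. g x * indicator A x \<partial>M)"
    by (simp_all add: emeasure_density)
  have "(\<integral>\<^sup>+x. f x * indicator A x \<partial>M) \<le> (\<integral>\<^sup>+x. g x * indicator A x \<partial>M)"
    using le_measureD3[OF le, of A] by (simp add: fA gA)
  moreover have "(\<integral>\<^sup>+x. g x * indicator A x \<partial>M) \<noteq> \<infinity>"
    using finite_measure.emeasure_finite[OF fin, of A] by (simp add: gA)
  moreover have "(\<integral>\<^sup>+x. f x * indicator A x - g x * indicator A x \<partial>M) =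
      (\<integral>\<^sup>+x. f x * indicator A x \<partial>M) - (\<integral>\<^sup>+x. g x * indicator A x \<partial>M)"
    using calculation by (intro nn_integral_diff) (auto simp: A_def split: split_indicator)
  ultimately have "(\<integral>\<^sup>+x. f x * indicator A x - g x * indicator A x \<partial>M) = 0"
    by (simp add: diff_eq_0_iff_ennreal top.not_eq_extremum)
  then have "AE x in M. f x * indicator A x - g x * indicator A x = 0"
    by (subst (asm) nn_integral_0_iff_AE) auto
  with AE_space show ?thesis
  proof eventually_elim
    case (elim x)
    then show ?case
      by (cases "x \<in> A") (auto simp: A_def diff_eq_0_iff_ennreal not_less)
  qed
qed

lemma emeasure_uniform_below:
  assumes "c \<le> 1"
  shows "emeasure (uniform_measure lborel {0..1}) {u::real. ennreal u < c} = c"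
proof -
  obtain r where r: "c = ennreal r" "0 \<le> r"
    using assms by (cases c) (auto simp: top_unique)
  then have "r \<le> 1" using assms by simp
  have "{0..1} \<inter> {u. ennreal u < c} = {0..<r}"
    using r \<open>r \<le> 1\<close> by (auto simp: ennreal_less_iff)
  then show ?thesis
    using r divide_ennreal[of r 1] by simp
qed

text \<open>
  A density with values in \<open>[0, 1]\<close> is the conditional probability, given \<open>y\<close>, that an independent
  uniform variable falls below \<open>f y\<close>.
\<close>

lemma emeasure_below_graph:
  assumes sets[measurable_cong]: "sets M = sets borel" and [measurable]: "f \<in> borel_measurable borel" "B \<in> sets borel"
    and le: "AE y in M. f y \<le> 1"
  shows "emeasure (M \<Otimes>\<^sub>M uniform_measure lborel {0..1::real})
      {z. fst z \<in> B \<and> ennreal (snd z) < f (fst z)} = emeasure (density M f) B"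
proof -
  let ?U = "uniform_measure lborel {0..1::real}"
  interpret U: prob_space ?U by (rule prob_space_uniform_measure) auto
  let ?E = "{z. fst z \<in> B \<and> ennreal (snd z) < f (fst z)}"
  have "{z\<in>space (M \<Otimes>\<^sub>M ?U). fst z \<in> B \<and> ennreal (snd z) < f (fst z)} \<in> sets (M \<Otimes>\<^sub>M ?U)"
    by measurable
  then have E: "?E \<in> sets (M \<Otimes>\<^sub>M ?U)"
    using sets_eq_imp_space_eq[OF sets] by (simp add: space_pair_measure)
  have "emeasure (M \<Otimes>\<^sub>M ?U) ?E = (\<integral>\<^sup>+y. emeasure ?U (Pair y -` ?E) \<partial>M)"
    by (rule U.emeasure_pair_measure_alt[OF E])
  also have "\<dots> = (\<integral>\<^sup>+y. f y * indicator B y \<partial>M)"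
  proof (rule nn_integral_cong_AE, use le in eventually_elim)
    fix y assume "f y \<le> 1"
    moreover have "Pair y -` ?E = (if y \<in> B then {u. ennreal u < f y} else {})" by auto
    ultimately show "emeasure ?U (Pair y -` ?E) = f y * indicator B y"
      using emeasure_uniform_below by simp
  qed
  also have "\<dots> = emeasure (density M f) B"
    by (simp add: emeasure_density)
  finally show ?thesis .
qed

text \<open>
  The difference of the two measures is itself a measure, so its value on \<open>B\<close> is at most its total mass.
  Limits of the slices are controlled through total masses by this inequality.
\<close>

lemma finite_borel_measure_mass_gap:
  assumes M: "finite_borel_measure M" and N: "finite_borel_measure N" and "M \<le> N" and B: "B \<in> sets borel"
  shows "measure N B \<le> measure M B + (measure N UNIV - measure M UNIV)"
proof -
  interpret M: finite_borel_measure M by fact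
  interpret N: finite_borel_measure N by fact
  note [simp] = M.M_is_borel N.M_is_borel M.borel_UNIV N.borel_UNIV
  have "measure M (UNIV - B) \<le> measure N (UNIV - B)"
    using assms finite_borel_measure_le_iff[OF M N] by simp
  then show ?thesis
    using B M.finite_measure_compl[of B] N.finite_measure_compl[of B] by simp
qed

lemma (in real_distribution) prob_greaterThan: "prob {x<..} = 1 - cdf M x"
proof -
  have "space M - {..x} = {x<..}" by auto
  then show ?thesis using prob_compl[of "{..x}"] by (simp add: cdf_def)
qed

text \<open>
  Let \<open>f x\<close> be the density of \<open>\<rho> x\<close> with respect to \<open>\<nu>\<close>.  It takes values in \<open>[0, 1]\<close> and decreases
  in \<open>x\<close> almost everywhere, so \<open>f x y\<close> can serve as the conditional probability that the first
  coordinate exceeds \<open>x\<close> when the second is \<open>y\<close>.  All these events are realised with one uniform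
  variable \<open>u\<close> by taking as first coordinate the supremum of the rationals \<open>q\<close> with \<open>u < f q y\<close>.
  The rationals make this measurable; that they suffice is the right continuity
  of \<open>x \<mapsto> \<rho> x\<close>, which follows from that of the total masses.
\<close>

lemma ex_measure_with_upper_slices:
  fixes \<rho> :: "real \<Rightarrow> real measure"
  assumes mu: "real_distribution \<mu>" and nu: "real_distribution \<nu>"
    and fin: "\<And>x. finite_borel_measure (\<rho> x)"
    and mass: "\<And>x. emeasure (\<rho> x) UNIV = emeasure \<mu> {x<..}"
    and le: "\<And>x. \<rho> x \<le> \<nu>"
    and anti: "\<And>x y. x \<le> y \<Longrightarrow> \<rho> y \<le> \<rho> x"
  shows "\<exists>P :: (real \<times> real) measure. prob_space P \<and> sets P = sets borel \<and>
    (\<forall>x. \<forall>B\<in>sets borel. emeasure P ({x<..} \<times> B) = emeasure (\<rho> x) B)"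
proof -
  interpret mu: real_distribution \<mu> by fact
  interpret nu: real_distribution \<nu> by fact
  interpret rho: finite_borel_measure "\<rho> x" for x by (rule fin)
  note [simp] = rho.M_is_borel rho.borel_UNIV
  define f where "f x = RN_deriv \<nu> (\<rho> x)" for x
  have f_meas_nu: "f x \<in> borel_measurable \<nu>" for x
    unfolding f_def by (rule borel_measurable_RN_deriv)
  then have f_meas[measurable]: "f x \<in> borel_measurable borel" for x
    by (simp cong: measurable_cong_sets)
  have dens: "density \<nu> (f x) = \<rho> x" for x
    unfolding f_def
  proof (rule nu.density_RN_deriv)
    show "absolutely_continuous \<nu> (\<rho> x)"
      using le_measureD3[OF le[of x]]
      by (auto simp: absolutely_continuous_def null_sets_def) (metis le_zero_eq)
  qed simp
  have f_le_1: "AE y in \<nu>. f x y \<le> 1" for x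
  proof (rule AE_le_if_density_le)
    show "density \<nu> (f x) \<le> density \<nu> (\<lambda>_. 1)"
      using le by (simp add: dens density_1)
    show "finite_measure (density \<nu> (\<lambda>_. 1))"
      by (simp add: density_1 nu.finite_measure_axioms)
  qed (use f_meas_nu in auto)
  have f_anti: "AE z in \<nu>. f y z \<le> f x z" if "x \<le> y" for x y
    using anti[OF that] rho.finite_measure_axioms
    by (intro AE_le_if_density_le f_meas_nu) (auto simp: dens)
  define U where "U = uniform_measure lborel {0..1::real}"
  interpret U: prob_space U unfolding U_def by (rule prob_space_uniform_measure) auto
  have sets_U[measurable_cong, simp]: "sets U = sets borel" by (simp add: U_def)
  define W where "W = \<nu> \<Otimes>\<^sub>M U"
  interpret nuU: pair_prob_space \<nu> U ..
  interpret W: prob_space W unfolding W_def by unfold_locales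
  have sets_W[measurable_cong]: "sets W = sets (borel \<Otimes>\<^sub>M borel)"
    unfolding W_def by (intro sets_pair_measure_cong) simp_all
  have space_W: "space W = UNIV"
    using sets_eq_imp_space_eq[OF sets_W] by (simp add: space_pair_measure)
  define E where "E x B = {z :: real \<times> real. fst z \<in> B \<and> ennreal (snd z) < f x (fst z)}" for x B
  have E_sets[measurable]: "E x B \<in> sets W" if [measurable]: "B \<in> sets borel" for x B
  proof -
    have "{z\<in>space W. fst z \<in> B \<and> ennreal (snd z) < f x (fst z)} \<in> sets W" by measurable
    then show ?thesis by (simp add: space_W E_def)
  qed
  have E_meas: "emeasure W (E x B) = emeasure (\<rho> x) B" if "B \<in> sets borel" for x B
    unfolding W_def E_def U_def using that f_le_1
    by (subst emeasure_below_graph) (auto simp: dens)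
  have E_anti: "AE z in W. z \<in> E y B \<longrightarrow> z \<in> E x B" if xy: "x \<le> y" for x y B
  proof -
    have "AE z in W. f y (fst z) \<le> f x (fst z)"
    proof -
      obtain N where N: "N \<in> null_sets \<nu>" "{z\<in>space \<nu>. \<not> f y z \<le> f x z} \<subseteq> N"
        using f_anti[OF xy] by (auto simp: eventually_ae_filter)
      have "emeasure W (N \<times> UNIV) = emeasure \<nu> N * emeasure U UNIV"
        unfolding W_def using N by (intro U.emeasure_pair_measure_Times) auto
      then have "N \<times> UNIV \<in> null_sets W"
        using N by (auto simp: null_sets_def sets_W)
      moreover have "{z\<in>space W. \<not> f y (fst z) \<le> f x (fst z)} \<subseteq> N \<times> UNIV"
        using N by auto
      ultimately show ?thesis by (rule AE_I')
    qed
    then show ?thesis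
      by eventually_elim (auto simp: E_def)
  qed
  define X where "X z = (SUP q\<in>\<rat>. if ennreal (snd z) < f q (fst z) then ereal q else -\<infinity>)"
    for z :: "real \<times> real"
  have X_gt: "ereal x < X z \<longleftrightarrow> (\<exists>q\<in>\<rat>. x < q \<and> ennreal (snd z) < f q (fst z))" for x z
    unfolding X_def by (subst less_SUP_iff) auto
  have X_meas[measurable]: "X \<in> borel_measurable W"
    unfolding X_def by (intro borel_measurable_SUP countable_rat) measurable
  have X_slice: "emeasure W {z. fst z \<in> B \<and> ereal x < X z} = emeasure (\<rho> x) B"
    if B[measurable]: "B \<in> sets borel" for x B
  proof (rule antisym)
    have eq: "{z. fst z \<in> B \<and> ereal x < X z} = (\<Union>q\<in>{q\<in>\<rat>. x < q}. E q B)"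
      by (auto simp: X_gt E_def)
    have cnt: "countable {q\<in>\<rat>. x < q}"
      by (rule countable_subset[OF _ countable_rat]) auto
    have meas: "{z. fst z \<in> B \<and> ereal x < X z} \<in> sets W"
      unfolding eq using cnt B by (intro sets.countable_UN') auto
    (* Upper bound: up to a null set, each of the countably many events for q > x
       lies in the single event that belongs to the density at x itself. *)
    have "AE z in W. \<forall>q\<in>{q\<in>\<rat>. x < q}. z \<in> E q B \<longrightarrow> z \<in> E x B"
      using cnt E_anti by (subst AE_ball_countable) auto
    then have "AE z in W. z \<in> {z. fst z \<in> B \<and> ereal x < X z} \<longrightarrow> z \<in> E x B"
      by eventually_elim (auto simp: eq)
    then show "emeasure W {z. fst z \<in> B \<and> ereal x < X z} \<le> emeasure (\<rho> x) B"
      unfolding E_meas[OF B, symmetric] by (rule emeasure_mono_AE[OF _ E_sets[OF B]])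
    (* Lower bound: one rational q > x loses at most the mass of \<mu> between x and q. *)
    have "measure (\<rho> x) B \<le> measure W {z. fst z \<in> B \<and> ereal x < X z}"
    proof (rule field_le_epsilon)
      fix e :: real assume "0 < e"
      have "(cdf \<mu> \<longlongrightarrow> cdf \<mu> x) (at_right x)"
        using mu.cdf_is_right_cont[of x] by (simp add: continuous_within)
      then have "eventually (\<lambda>t. cdf \<mu> t < cdf \<mu> x + e) (at_right x)"
        using \<open>0 < e\<close> by (intro order_tendstoD(2)) auto
      then obtain b where b: "x < b" "\<And>t. x < t \<Longrightarrow> t < b \<Longrightarrow> cdf \<mu> t < cdf \<mu> x + e"
        by (auto simp: eventually_at_right_field)
      obtain q where q: "q \<in> \<rat>" "x < q" "q < b"
        using Rats_dense_in_real[OF b(1)] by auto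
      have mass': "measure (\<rho> t) UNIV = 1 - cdf \<mu> t" for t
        using mass[of t] mu.prob_greaterThan[of t] by (simp add: measure_def)
      have "measure (\<rho> x) B \<le> measure (\<rho> q) B + (measure (\<rho> x) UNIV - measure (\<rho> q) UNIV)"
        using finite_borel_measure_mass_gap[OF fin fin anti B] q by simp
      also have "\<dots> \<le> measure (\<rho> q) B + e"
        using b(2)[OF q(2,3)] by (simp add: mass')
      also have "measure (\<rho> q) B = measure W (E q B)"
        using E_meas[OF B] by (simp add: measure_def)
      also have "\<dots> \<le> measure W {z. fst z \<in> B \<and> ereal x < X z}"
        using meas q by (intro W.finite_measure_mono) (auto simp: eq)
      finally show "measure (\<rho> x) B \<le> measure W {z. fst z \<in> B \<and> ereal x < X z} + e"
        by simp
    qed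
    then show "emeasure (\<rho> x) B \<le> emeasure W {z. fst z \<in> B \<and> ereal x < X z}"
      by (simp add: rho.emeasure_eq_measure W.emeasure_eq_measure)
  qed
  have X_tail: "measure W {z. ereal x < X z} = 1 - cdf \<mu> x" for x
    using X_slice[of UNIV x] mass[of x] mu.prob_greaterThan[of x] by (simp add: measure_def)
  (* The slice identity with B = UNIV gives X the tails of the probability measure \<mu>, so X is almost
     surely a real number. *)
  have "AE z in W. X z \<noteq> \<infinity>"
  proof -
    have "measure W {z. X z = \<infinity>} \<le> 1 - cdf \<mu> (real n)" for n
      unfolding X_tail[symmetric]
    proof (rule W.finite_measure_mono)
      have "{z\<in>space W. ereal (real n) < X z} \<in> sets W" by measurable
      then show "{z. ereal (real n) < X z} \<in> sets W" by (simp add: space_W)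
    qed auto
    then have "measure W {z. X z = \<infinity>} \<le> 1 - 1"
      by (intro LIMSEQ_le_const[OF tendsto_diff[OF tendsto_const mu.cdf_lim_infty_prob]]) auto
    then have "measure W {z. X z = \<infinity>} = 0"
      by (simp add: measure_le_0_iff)
    moreover have "{z\<in>space W. X z = \<infinity>} \<in> sets W" by measurable
    ultimately have "{z\<in>space W. X z = \<infinity>} \<in> null_sets W"
      by (simp add: null_sets_def W.emeasure_eq_measure space_W)
    then show ?thesis by (rule AE_I') auto
  qed
  moreover have "AE z in W. X z \<noteq> -\<infinity>"
  proof -
    have "measure W {z. X z = -\<infinity>} \<le> cdf \<mu> (- real n)" for n
    proof -
      have "measure W {z. X z = -\<infinity>} \<le> measure W (space W - {z\<in>space W. ereal (- real n) < X z})"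
      proof (rule W.finite_measure_mono)
        show "space W - {z\<in>space W. ereal (- real n) < X z} \<in> sets W" by measurable
      qed (auto simp: space_W)
      also have "\<dots> = cdf \<mu> (- real n)"
      proof (subst W.prob_compl)
        show "{z\<in>space W. ereal (- real n) < X z} \<in> sets W" by measurable
      qed (simp add: space_W X_tail del: uminus_ereal.simps)
      finally show ?thesis .
    qed
    then have "measure W {z. X z = -\<infinity>} \<le> 0"
      by (intro LIMSEQ_le_const[OF mu.cdf_lim_neg_infty]) auto
    then have "measure W {z. X z = -\<infinity>} = 0"
      by (simp add: measure_le_0_iff)
    moreover have "{z\<in>space W. X z = -\<infinity>} \<in> sets W" by measurable
    ultimately have "{z\<in>space W. X z = -\<infinity>} \<in> null_sets W"
      by (simp add: null_sets_def W.emeasure_eq_measure space_W)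
    then show ?thesis by (rule AE_I') auto
  qed
  ultimately have X_real: "AE z in W. \<bar>X z\<bar> \<noteq> \<infinity>"
    by eventually_elim auto
  define g where "g z = (real_of_ereal (X z), fst z)" for z
  have g_meas[measurable]: "g \<in> W \<rightarrow>\<^sub>M borel"
    unfolding g_def[abs_def] borel_prod[symmetric] by measurable
  define P where "P = distr W borel g"
  have "prob_space P" unfolding P_def by (intro W.prob_space_distr g_meas)
  moreover have "sets P = sets borel" by (simp add: P_def)
  moreover have "emeasure P ({x<..} \<times> B) = emeasure (\<rho> x) B" if B: "B \<in> sets borel" for x B
  proof -
    have R: "{x<..} \<times> B \<in> sets borel"
      using B unfolding borel_prod[symmetric] by measurable
    have "emeasure P ({x<..} \<times> B) = emeasure W (g -` ({x<..} \<times> B) \<inter> space W)"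
      unfolding P_def using R by (intro emeasure_distr g_meas)
    also have "\<dots> = emeasure W {z. fst z \<in> B \<and> ereal x < X z}"
    proof (rule emeasure_eq_AE)
      show "AE z in W. (z \<in> g -` ({x<..} \<times> B) \<inter> space W) = (z \<in> {z. fst z \<in> B \<and> ereal x < X z})"
        using X_real
      proof eventually_elim
        case (elim z)
        then show ?case by (cases "X z") (auto simp: g_def space_W)
      qed
      show "g -` ({x<..} \<times> B) \<inter> space W \<in> sets W"
        using R by measurable
      have "{z\<in>space W. fst z \<in> B \<and> ereal x < X z} \<in> sets W"
        using B by measurable
      then show "{z. fst z \<in> B \<and> ereal x < X z} \<in> sets W" by (simp add: space_W)
    qed
    finally show ?thesis using X_slice[OF B] by simp
  qed
  ultimately show ?thesis by blast
qed

text \<open>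
  The rectangles \<open>{x<..} \<times> B\<close> are closed under intersection, generate the Borel sets of the plane, and
  exhaust it along \<open>x = -n\<close>.
\<close>

lemma measure_eqI_upper_slices:
  fixes P Q :: "(real \<times> real) measure"
  assumes "finite_measure P" and sets: "sets P = sets borel" "sets Q = sets borel"
    and eq: "\<And>x B. B \<in> sets borel \<Longrightarrow> emeasure P ({x<..} \<times> B) = emeasure Q ({x<..} \<times> B)"
  shows "P = Q"
proof -
  let ?E = "{a \<times> b |a b. a \<in> range (\<lambda>x::real. {x<..}) \<and> b \<in> sets (borel :: real measure)}"
  have U: "(\<Union>n. {- real n<..}) = (UNIV :: real set)"
    by auto (metis minus_less_iff reals_Archimedean2)
  have gen: "sets (borel :: (real \<times> real) measure) = sigma_sets UNIV ?E"
  proof -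
    have "sets (borel \<Otimes>\<^sub>M borel :: (real \<times> real) measure) =
        sets (sigma (space (borel :: real measure) \<times> space (borel :: real measure)) ?E)"
    proof (rule sets_pair_eq)
      show "sets (borel :: real measure) = sigma_sets (space borel) (range (\<lambda>x. {x<..}))"
        by (subst borel_Ioi) simp
      show "sets (borel :: real measure) = sigma_sets (space borel) (sets borel)"
        using sets.sigma_sets_eq[of "borel :: real measure"] by simp
      show "countable (range (\<lambda>n. {- real n<..}))" by simp
      show "\<Union> (range (\<lambda>n. {- real n<..})) = space (borel :: real measure)" using U by simp
      show "countable {UNIV :: real set}" "{UNIV} \<subseteq> sets (borel :: real measure)"
        "\<Union> {UNIV} = space (borel :: real measure)" by auto
    qed auto
    then show ?thesis unfolding borel_prod by simp
  qed
  show ?thesis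
  proof (rule measure_eqI_generator_eq)
    show "Int_stable ?E"
    proof (rule Int_stableI)
      fix A B assume "A \<in> ?E" "B \<in> ?E"
      then obtain x a y b where AB: "A = {x<..} \<times> a" "B = {y<..} \<times> b"
        and ab: "a \<in> sets borel" "b \<in> sets borel"
        by auto
      have "A \<inter> B = {max x y<..} \<times> (a \<inter> b)" using AB by auto
      moreover have "a \<inter> b \<in> sets borel" using ab by (rule sets.Int)
      ultimately show "A \<inter> B \<in> ?E"
        by (intro CollectI exI[of _ "{max x y<..}"] exI[of _ "a \<inter> b"]) simp
    qed
    show "range (\<lambda>n. {- real n<..} \<times> UNIV) \<subseteq> ?E"
      by (intro image_subsetI CollectI exI conjI refl) auto
    show "(\<Union>n. {- real n<..} \<times> UNIV) = (UNIV :: (real \<times> real) set)"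
      using U by (simp add: set_eq_iff)
    show "emeasure P ({- real n<..} \<times> UNIV) \<noteq> \<infinity>" for n
      using assms(1) by (simp add: finite_measure.emeasure_finite)
  qed (use sets gen eq in auto)
qed

section \<open>Upward and downward closed sets of reals\<close>

lemma upward_closed_real_cases:
  fixes U :: "real set"
  assumes up: "\<And>a b. a \<in> U \<Longrightarrow> a \<le> b \<Longrightarrow> b \<in> U"
  obtains "U = {}" | "U = UNIV" | a where "U = {a<..}" | a where "U = {a..}"
proof (cases "U = {} \<or> \<not> bdd_below U")
  case True
  moreover have "U = UNIV" if "\<not> bdd_below U"
  proof -
    have "x \<in> U" for x
      using that up by (metis bdd_below.I nle_le)
    then show ?thesis by auto
  qed
  ultimately show ?thesis using that(1,2) by metis
next
  case False
  then have bdd: "bdd_below U" "U \<noteq> {}" by auto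
  have "{Inf U<..} \<subseteq> U"
    using up cInf_less_iff[OF bdd(2,1)] by fastforce
  moreover have "U \<subseteq> {Inf U..}"
    using cInf_lower[OF _ bdd(1)] by auto
  ultimately have "U = {Inf U<..} \<or> U = {Inf U..}"
    by (cases "Inf U \<in> U") (auto simp: less_le)
  then show ?thesis using that by blast
qed

lemma upward_closed_borel:
  fixes U :: "real set"
  assumes "\<And>a b. a \<in> U \<Longrightarrow> a \<le> b \<Longrightarrow> b \<in> U"
  shows "U \<in> sets borel"
  using assms by (rule upward_closed_real_cases) auto

text \<open>
  An upward closed set is comparable by inclusion with every open ray, so here a small difference of
  masses means a small symmetric difference: open rays approximate all upward closed sets.
\<close>

lemma (in real_distribution) upward_closed_approx:
  fixes U :: "real set"
  assumes up: "\<And>a b. a \<in> U \<Longrightarrow> a \<le> b \<Longrightarrow> b \<in> U" and "0 < e"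
  shows "\<exists>x. \<bar>prob {x<..} - prob U\<bar> < e"
  using up
proof (rule upward_closed_real_cases)
  assume "U = {}"
  have "\<forall>\<^sub>F n in sequentially. 1 - e < cdf M (real n)"
    using \<open>0 < e\<close> by (intro order_tendstoD(1)[OF cdf_lim_infty_prob]) auto
  then obtain n where "1 - e < cdf M (real n)"
    by (auto simp: eventually_sequentially)
  then show ?thesis
    using cdf_bounded_prob[of "real n"] \<open>U = {}\<close> by (intro exI[of _ "real n"]) (simp add: prob_greaterThan)
next
  assume "U = UNIV"
  have "\<forall>\<^sub>F n in sequentially. cdf M (- real n) < e"
    using \<open>0 < e\<close> by (intro order_tendstoD(2)[OF cdf_lim_neg_infty]) auto
  then obtain n where "cdf M (- real n) < e"
    by (auto simp: eventually_sequentially)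
  then show ?thesis
    using cdf_nonneg[of "- real n"] \<open>U = UNIV\<close> prob_space
    by (intro exI[of _ "- real n"]) (simp add: prob_greaterThan)
next
  fix a assume "U = {a<..}"
  then show ?thesis using \<open>0 < e\<close> by (intro exI[of _ a]) simp
next
  fix a assume U: "U = {a..}"
  have "space M - {..<a} = U" using U by auto
  then have prob_U: "prob U = 1 - prob {..<a}"
    using prob_compl[of "{..<a}"] by simp
  have "\<forall>\<^sub>F x in at_left a. prob {..<a} - e < cdf M x"
    using \<open>0 < e\<close> by (intro order_tendstoD(1)[OF cdf_at_left]) auto
  moreover have "\<forall>\<^sub>F x in at_left a. x < a"
    by (simp add: eventually_at_filter)
  ultimately have "\<forall>\<^sub>F x in at_left a. prob {..<a} - e < cdf M x \<and> x < a"
    by (rule eventually_conj)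
  then obtain x where x: "prob {..<a} - e < cdf M x" "x < a"
    using eventually_happens'[OF trivial_limit_at_left_real] by blast
  have "cdf M x \<le> prob {..<a}"
    unfolding cdf_def using x by (intro finite_measure_mono) auto
  then show ?thesis
    using x prob_U by (intro exI[of _ x]) (simp add: prob_greaterThan)
qed

text \<open>
  Besides the half-lines \<open>{..a}\<close> of the definition, a downward closed set can be an open half-line,
  which is a limit of closed ones, or trivial.
\<close>

lemma st_le_downward_closed:
  assumes K: "finite_borel_measure \<kappa>" and T: "finite_borel_measure \<theta>" and st: "\<kappa> \<preceq>\<^sub>s\<^sub>t \<theta>"
    and down: "\<And>a b. b \<in> L \<Longrightarrow> a \<le> b \<Longrightarrow> a \<in> L"
  shows "measure \<theta> L \<le> measure \<kappa> L"
proof -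
  have cdf_le: "cdf \<theta> t \<le> cdf \<kappa> t" for t using st by (auto simp: st_le_def)
  have mass: "measure \<theta> UNIV = measure \<kappa> UNIV" using st by (simp add: st_le_def measure_def)
  have "b \<in> - L" if "a \<in> - L" "a \<le> b" for a b using that down by blast
  then show ?thesis
  proof (rule upward_closed_real_cases)
    assume "- L = {}"
    then have "L = UNIV" by auto
    then show ?thesis using mass by simp
  next
    assume "- L = UNIV"
    then have "L = {}" by auto
    then show ?thesis by simp
  next
    fix a assume "- L = {a<..}"
    then have "L = - {a<..}" by (metis double_complement)
    then have "L = {..a}" by auto
    then show ?thesis using cdf_le[of a] by (simp add: cdf_def)
  next
    fix a assume "- L = {a..}"
    then have "L = - {a..}" by (metis double_complement)
    then have "L = {..<a}" by auto
    then show ?thesis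
      using cdf_le tendsto_le[OF trivial_limit_at_left_real
          finite_borel_measure.cdf_at_left[OF K, of a] finite_borel_measure.cdf_at_left[OF T, of a]]
      by (simp add: always_eventually)
  qed
qed

section \<open>Least targets and their images under strictly increasing maps\<close>

definition least_target :: "real measure \<Rightarrow> real measure \<Rightarrow> real measure \<Rightarrow> bool"
  where "least_target \<kappa> \<nu> \<theta> \<longleftrightarrow>
    \<theta> \<in> st_targets \<kappa> \<nu> \<and> (\<forall>\<theta>'\<in>st_targets \<kappa> \<nu>. \<theta> \<preceq>\<^sub>s\<^sub>t \<theta>')"

lemma least_target_earliest_target:
  assumes "finite_borel_measure \<kappa>" "finite_borel_measure \<nu>"
    and "\<And>s. measure \<kappa> {s<..} \<le> measure \<nu> {s<..}"
  shows "least_target \<kappa> \<nu> (earliest_target \<kappa> \<nu>)"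
  using finite_borel_measure_earliest_target[OF assms] st_le_earliest_target[OF assms]
    earliest_target_le[OF assms] earliest_target_least[OF assms]
  by (auto simp: least_target_def st_targets_def)

lemma st_le_antisym:
  assumes "finite_borel_measure \<theta>" "finite_borel_measure \<theta>'" "\<theta> \<preceq>\<^sub>s\<^sub>t \<theta>'" "\<theta>' \<preceq>\<^sub>s\<^sub>t \<theta>"
  shows "\<theta> = \<theta>'"
  using assms by (intro cdf_unique') (auto simp: st_le_def fun_eq_iff intro: antisym)

lemma target_candidates_eq_st_targets:
  assumes "sets \<nu> = sets borel"
  shows "target_candidates \<mu> \<nu> x = st_targets (density \<mu> (indicator {x<..})) \<nu>"
  using assms
  by (auto simp: target_candidates_def st_targets_def le_measure finite_borel_measure.M_is_borel)

text \<open>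
  A least element is the only minimal one, since the stochastic order is antisymmetric on
  finite Borel measures.
\<close>

lemma minimal_target_eq_least_target:
  assumes "sets \<nu> = sets borel" and L: "least_target (density \<mu> (indicator {x<..})) \<nu> \<theta>"
  shows "minimal_target \<mu> \<nu> x = \<theta>"
  unfolding minimal_target_def target_candidates_eq_st_targets[OF assms(1)]
proof (rule the_equality)
  let ?T = "st_targets (density \<mu> (indicator {x<..})) \<nu>"
  have fin: "\<theta>' \<in> ?T \<Longrightarrow> finite_borel_measure \<theta>'" for \<theta>' by (simp add: st_targets_def)
  show "\<theta> \<in> ?T \<and> (\<forall>\<theta>'\<in>?T. \<theta>' \<preceq>\<^sub>s\<^sub>t \<theta> \<longrightarrow> \<theta>' = \<theta>)"
    using L fin st_le_antisym by (auto simp: least_target_def)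
  fix \<theta>' assume "\<theta>' \<in> ?T \<and> (\<forall>\<theta>\<in>?T. \<theta> \<preceq>\<^sub>s\<^sub>t \<theta>' \<longrightarrow> \<theta> = \<theta>')"
  then show "\<theta>' = \<theta>" using L by (auto simp: least_target_def)
qed

text \<open>
  The natural left inverse \<open>z \<mapsto> sup {x. \<phi> x \<le> z}\<close> is monotone, but the set can be empty or unbounded
  when \<open>z\<close> lies outside the convex hull of the range.  Compressing the line with \<open>arctan\<close> bounds the
  set, and adding the point \<open>-2 < -\<pi>/2\<close> makes it nonempty without changing the supremum at
  points of the range; applying \<open>tan\<close> undoes the compression.
\<close>

lemma strict_mono_borel_left_inverse:
  fixes \<phi> :: "real \<Rightarrow> real"
  assumes "strict_mono \<phi>"
  obtains \<psi> where "\<psi> \<in> borel_measurable borel" "\<And>x. \<psi> (\<phi> x) = x"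
proof
  define S where "S z = insert (-2) (arctan ` {x. \<phi> x \<le> z})" for z
  have pi: "-2 < arctan x" "arctan x < 2" for x
    using arctan_bounded[of x] pi_less_4 by auto
  have bdd: "bdd_above (S z)" for z
    using pi by (auto simp: S_def intro!: bdd_aboveI[of _ 2] less_imp_le)
  have "mono (\<lambda>z. Sup (S z))"
    by (intro monoI cSup_subset_mono bdd) (auto simp: S_def)
  then have [measurable]: "(\<lambda>z. Sup (S z)) \<in> borel_measurable borel"
    by (rule borel_measurable_mono)
  show "(\<lambda>z. tan (Sup (S z))) \<in> borel_measurable borel"
    unfolding tan_def by measurable
  show "tan (Sup (S (\<phi> x))) = x" for x
  proof -
    have "Sup (S (\<phi> x)) = arctan x"
      using pi[of x] strict_mono_less_eq[OF assms]
      by (intro cSup_eq_maximum) (auto simp: S_def arctan_le_iff less_imp_le)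
    then show ?thesis by (simp add: tan_arctan)
  qed
qed

lemma finite_borel_measure_distr:
  assumes "finite_borel_measure M" "f \<in> borel_measurable borel"
  shows "finite_borel_measure (distr M borel f)"
proof -
  interpret M: finite_borel_measure M by fact
  have "f \<in> borel_measurable M" using assms(2) M.M_is_borel by (simp cong: measurable_cong_sets)
  then show ?thesis
    using M.finite_measure_distr by (simp add: finite_borel_measure_def finite_borel_measure_axioms_def)
qed

lemma emeasure_distr_borel:
  assumes "sets M = sets borel" "f \<in> borel_measurable borel" "A \<in> sets borel"
  shows "emeasure (distr M borel f) A = emeasure M (f -` A)"
proof -
  have "f \<in> borel_measurable M" using assms by (simp cong: measurable_cong_sets)
  then show ?thesis
    using assms sets_eq_imp_space_eq[OF assms(1)] by (simp add: emeasure_distr)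
qed

lemma distr_borel_mono:
  assumes "sets M = sets borel" "sets N = sets borel" "f \<in> borel_measurable borel" "M \<le> N"
  shows "distr M borel f \<le> distr N borel f"
  using assms le_measureD3[of M N] by (simp add: le_measure emeasure_distr_borel)

lemma st_le_distr_mono:
  fixes \<phi> :: "real \<Rightarrow> real"
  assumes K: "finite_borel_measure \<kappa>" and T: "finite_borel_measure \<theta>" and st: "\<kappa> \<preceq>\<^sub>s\<^sub>t \<theta>"
    and "mono \<phi>"
  shows "distr \<kappa> borel \<phi> \<preceq>\<^sub>s\<^sub>t distr \<theta> borel \<phi>"
proof -
  note meas = borel_measurable_mono[OF \<open>mono \<phi>\<close>]
  note sets = K[THEN finite_borel_measure.M_is_borel] T[THEN finite_borel_measure.M_is_borel]
  have "measure \<theta> (\<phi> -` {..t}) \<le> measure \<kappa> (\<phi> -` {..t})" for t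
    by (rule st_le_downward_closed[OF K T st]) (use monoD[OF \<open>mono \<phi>\<close>] in \<open>auto intro: order_trans\<close>)
  then show ?thesis
    using st by (auto simp: st_le_def cdf_def measure_def emeasure_distr_borel sets meas)
qed

text \<open>
  A target of the image measures is dominated by \<open>distr \<nu> borel \<phi>\<close>, hence concentrated on the range
  of \<open>\<phi>\<close>, where \<open>\<phi>\<close> and its left inverse \<open>\<psi>\<close> are mutually inverse.  It is therefore the image of its
  own pullback under \<open>\<psi>\<close>, which is a target of the original measures and so lies above the
  least one.
\<close>

lemma least_target_distr:
  fixes \<phi> :: "real \<Rightarrow> real"
  assumes K: "finite_borel_measure \<kappa>" and N: "finite_borel_measure \<nu>" and "strict_mono \<phi>"
    and L: "least_target \<kappa> \<nu> \<theta>"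
  shows "least_target (distr \<kappa> borel \<phi>) (distr \<nu> borel \<phi>) (distr \<theta> borel \<phi>)"
proof -
  note mono = strict_mono_mono[OF \<open>strict_mono \<phi>\<close>]
  note meas[measurable] = borel_measurable_mono[OF mono]
  obtain \<psi> where \<psi>[measurable]: "\<psi> \<in> borel_measurable borel" and inv: "\<And>x. \<psi> (\<phi> x) = x"
    using strict_mono_borel_left_inverse[OF \<open>strict_mono \<phi>\<close>] by blast
  have T: "finite_borel_measure \<theta>" and st: "\<kappa> \<preceq>\<^sub>s\<^sub>t \<theta>" and le: "\<theta> \<le> \<nu>"
    using L by (auto simp: least_target_def st_targets_def)
  note sets = K[THEN finite_borel_measure.M_is_borel] N[THEN finite_borel_measure.M_is_borel]
    T[THEN finite_borel_measure.M_is_borel]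
  have "distr \<theta> borel \<phi> \<preceq>\<^sub>s\<^sub>t \<theta>'"
    if \<theta>': "\<theta>' \<in> st_targets (distr \<kappa> borel \<phi>) (distr \<nu> borel \<phi>)" for \<theta>'
  proof -
    have T': "finite_borel_measure \<theta>'" and st': "distr \<kappa> borel \<phi> \<preceq>\<^sub>s\<^sub>t \<theta>'"
      and le': "\<theta>' \<le> distr \<nu> borel \<phi>"
      using \<theta>' by (auto simp: st_targets_def)
    note sets' = T'[THEN finite_borel_measure.M_is_borel]
    define R where "R = {z. \<phi> (\<psi> z) = z}"
    have R[measurable]: "R \<in> sets borel" unfolding R_def by measurable
    have "emeasure (distr \<nu> borel \<phi>) (- R) = emeasure \<nu> (\<phi> -` (- R))"
      by (rule emeasure_distr_borel) (use sets in auto)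
    also have "\<phi> -` (- R) = {}" by (auto simp: R_def inv)
    finally have null: "emeasure \<theta>' (- R) = 0"
      using le_measureD3[OF le', of "- R"] sets' by simp
    have on_R: "emeasure \<theta>' A = emeasure \<theta>' B"
      if "A \<in> sets borel" "B \<in> sets borel" "A \<inter> R = B \<inter> R" for A B
    proof (rule emeasure_eq_AE)
      have "AE z in \<theta>'. z \<in> R"
        by (rule AE_I[of _ _ "- R"]) (use null sets' R in auto)
      then show "AE z in \<theta>'. (z \<in> A) = (z \<in> B)"
        by eventually_elim (use that in auto)
    qed (use that sets' in auto)
    have push: "distr (distr \<theta>' borel \<psi>) borel \<phi> = \<theta>'"
    proof (rule measure_eqI)
      fix A assume "A \<in> sets (distr (distr \<theta>' borel \<psi>) borel \<phi>)"
      then have A[measurable]: "A \<in> sets borel" by simp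
      have "emeasure (distr (distr \<theta>' borel \<psi>) borel \<phi>) A = emeasure \<theta>' (\<psi> -` \<phi> -` A)"
        using sets' measurable_sets_borel[OF meas A] by (simp add: emeasure_distr_borel \<psi> meas)
      also have "\<dots> = emeasure \<theta>' A"
        using measurable_sets_borel[OF \<psi> measurable_sets_borel[OF meas A]]
        by (intro on_R) (auto simp: R_def)
      finally show "emeasure (distr (distr \<theta>' borel \<psi>) borel \<phi>) A = emeasure \<theta>' A" .
    qed (simp add: sets')
    have "distr \<theta>' borel \<psi> \<in> st_targets \<kappa> \<nu>"
    proof -
      have "distr \<theta>' borel \<psi> \<le> distr (distr \<nu> borel \<phi>) borel \<psi>"
        using le' sets' by (intro distr_borel_mono \<psi>) auto
      also have "distr (distr \<nu> borel \<phi>) borel \<psi> = \<nu>"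
        using sets by (intro measure_eqI)
          (auto simp: emeasure_distr_borel measurable_sets_borel[OF \<psi>] meas vimage_def inv)
      finally have "distr \<theta>' borel \<psi> \<le> \<nu>" .
      moreover have "cdf (distr \<theta>' borel \<psi>) t \<le> cdf \<kappa> t" for t
      proof -
        have "emeasure (distr \<theta>' borel \<psi>) {..t} = emeasure \<theta>' (\<psi> -` {..t})"
          using sets' by (simp add: emeasure_distr_borel)
        also have "\<dots> = emeasure \<theta>' {..\<phi> t}"
          using measurable_sets_borel[OF \<psi>, of "{..t}"] strict_mono_less_eq[OF \<open>strict_mono \<phi>\<close>]
          by (intro on_R) (auto simp: R_def, metis+)
        finally have "cdf (distr \<theta>' borel \<psi>) t = cdf \<theta>' (\<phi> t)"
          by (simp add: cdf_def measure_def)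
        also have "\<dots> \<le> cdf (distr \<kappa> borel \<phi>) (\<phi> t)"
          using st' by (simp add: st_le_def)
        also have "\<phi> -` {..\<phi> t} = {..t}"
          using strict_mono_less_eq[OF \<open>strict_mono \<phi>\<close>] by auto
        then have "cdf (distr \<kappa> borel \<phi>) (\<phi> t) = cdf \<kappa> t"
          by (simp add: cdf_def measure_def emeasure_distr_borel sets)
        finally show ?thesis .
      qed
      moreover have "emeasure (distr \<theta>' borel \<psi>) UNIV = emeasure \<kappa> UNIV"
        using st' by (simp add: st_le_def emeasure_distr_borel sets sets')
      ultimately show ?thesis
        by (simp add: st_targets_def st_le_def finite_borel_measure_distr T')
    qed
    then have "\<theta> \<preceq>\<^sub>s\<^sub>t distr \<theta>' borel \<psi>"
      using L by (auto simp: least_target_def)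
    then have "distr \<theta> borel \<phi> \<preceq>\<^sub>s\<^sub>t distr (distr \<theta>' borel \<psi>) borel \<phi>"
      by (intro st_le_distr_mono T finite_borel_measure_distr T' \<psi> mono)
    then show ?thesis by (simp add: push)
  qed
  moreover have "distr \<theta> borel \<phi> \<in> st_targets (distr \<kappa> borel \<phi>) (distr \<nu> borel \<phi>)"
    using st_le_distr_mono[OF K T st mono] distr_borel_mono[OF _ _ meas le] sets
    by (simp add: st_targets_def finite_borel_measure_distr T)
  ultimately show ?thesis by (simp add: least_target_def)
qed

section \<open>The optimal coupling and its image\<close>

lemma real_distribution_eqI_le:
  assumes M: "real_distribution M" and N: "real_distribution N" and "M \<le> N"
  shows "M = N"
proof -
  interpret M: real_distribution M by fact
  interpret N: real_distribution N by fact
  have "measure N B = measure M B" if "B \<in> sets borel" for B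
    using finite_borel_measure_mass_gap[OF M.finite_borel_measure_M N.finite_borel_measure_M \<open>M \<le> N\<close> that]
      finite_borel_measure_le_iff[OF M.finite_borel_measure_M N.finite_borel_measure_M] assms(3) that
      M.prob_space N.prob_space
    by (simp add: antisym)
  then show ?thesis
    by (intro measure_eqI) (auto simp: M.emeasure_eq_measure N.emeasure_eq_measure)
qed

definition is_optimal_coupling :: "real measure \<Rightarrow> real measure \<Rightarrow> (real \<times> real) measure \<Rightarrow> bool"
  where "is_optimal_coupling \<mu> \<nu> P \<longleftrightarrow> directional_coupling \<mu> \<nu> P \<and>
    (\<forall>x. \<forall>B\<in>sets borel. emeasure P ({x<..} \<times> B) = emeasure (minimal_target \<mu> \<nu> x) B)"

lemma optimal_directional_coupling_eqI:
  assumes P: "is_optimal_coupling \<mu> \<nu> P"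
  shows "P\<^sub>* \<mu> \<nu> = P"
  unfolding optimal_directional_coupling_def
proof (rule the_equality)
  fix Q assume Q: "directional_coupling \<mu> \<nu> Q \<and>
    (\<forall>x. \<forall>B\<in>sets borel. emeasure Q ({x<..} \<times> B) = emeasure (minimal_target \<mu> \<nu> x) B)"
  show "Q = P"
    using P Q
    by (intro measure_eqI_upper_slices)
      (auto simp: is_optimal_coupling_def directional_coupling_def prob_space.finite_measure)
qed (use P in \<open>auto simp: is_optimal_coupling_def\<close>)

lemma measurable_map_prod_borel:
  fixes \<phi> :: "real \<Rightarrow> real"
  assumes [measurable]: "\<phi> \<in> borel_measurable borel" and sets: "sets P = sets borel"
  shows "map_prod \<phi> \<phi> \<in> P \<rightarrow>\<^sub>M borel"
  unfolding measurable_cong_sets[OF sets refl] borel_prod[symmetric] map_prod_def by measurable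

locale st_ordered_distributions =
  fixes \<mu> \<nu> :: "real measure"
  assumes mu: "real_distribution \<mu>" and nu: "real_distribution \<nu>" and st: "\<mu> \<preceq>\<^sub>s\<^sub>t \<nu>"
begin

sublocale mu: real_distribution \<mu> by (rule mu)
sublocale nu: real_distribution \<nu> by (rule nu)

definition restr :: "real set \<Rightarrow> real measure"
  where "restr U = density \<mu> (indicator U)"

lemma emeasure_restr:
  assumes "U \<in> sets borel" "A \<in> sets borel"
  shows "emeasure (restr U) A = emeasure \<mu> (U \<inter> A)"
  unfolding restr_def using assms
  by (subst emeasure_density) (auto simp: indicator_inter_arith[symmetric] nn_integral_indicator)

lemma finite_restr:
  assumes "U \<in> sets borel" shows "finite_borel_measure (restr U)"
proof -
  have "emeasure (restr U) UNIV \<noteq> \<infinity>"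
    using emeasure_restr[OF assms, of UNIV] by simp
  moreover have "sets (restr U) = sets borel" "space (restr U) = UNIV"
    by (simp_all add: restr_def)
  ultimately show ?thesis
    by (intro finite_borel_measure.intro finite_measureI) (simp_all add: finite_borel_measure_axioms_def)
qed

lemma restr_mono:
  assumes "U \<in> sets borel" "V \<in> sets borel" "U \<subseteq> V" shows "restr U \<le> restr V"
proof -
  have "sets (restr U) = sets borel" "sets (restr V) = sets borel" by (simp_all add: restr_def)
  moreover have "emeasure (restr U) A \<le> emeasure (restr V) A" if "A \<in> sets borel" for A
    using assms that by (auto simp: emeasure_restr intro!: emeasure_mono)
  ultimately show ?thesis by (simp add: le_measure)
qed

lemma restr_tails:
  assumes "U \<in> sets borel" shows "measure (restr U) {s<..} \<le> measure \<nu> {s<..}"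
proof -
  have "measure (restr U) {s<..} \<le> measure \<mu> {s<..}"
    using assms by (simp add: measure_def emeasure_restr enn2real_mono emeasure_mono
        less_top[symmetric] mu.emeasure_finite)
  also have "\<dots> \<le> measure \<nu> {s<..}"
    using st by (simp add: mu.prob_greaterThan nu.prob_greaterThan st_le_def)
  finally show ?thesis .
qed

definition slice :: "real set \<Rightarrow> real measure"
  where "slice U = earliest_target (restr U) \<nu>"

lemma
  assumes "U \<in> sets borel"
  shows finite_slice: "finite_borel_measure (slice U)"
    and slice_UNIV: "emeasure (slice U) UNIV = emeasure \<mu> U"
    and slice_le: "slice U \<le> \<nu>"
    and least_target_slice: "least_target (restr U) \<nu> (slice U)"
proof -
  note * = finite_restr[OF assms] nu.finite_borel_measure_M restr_tails[OF assms]
  show "finite_borel_measure (slice U)" "slice U \<le> \<nu>" "least_target (restr U) \<nu> (slice U)"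
    unfolding slice_def
    by (rule finite_borel_measure_earliest_target[OF *] earliest_target_le[OF *]
        least_target_earliest_target[OF *])+
  show "emeasure (slice U) UNIV = emeasure \<mu> U"
    unfolding slice_def using assms by (simp add: emeasure_earliest_target_UNIV[OF *] emeasure_restr)
qed

lemma slice_mono:
  assumes "U \<in> sets borel" "V \<in> sets borel" "U \<subseteq> V" shows "slice U \<le> slice V"
  unfolding slice_def
  by (intro earliest_target_mono finite_restr restr_mono nu.finite_borel_measure_M restr_tails assms)

lemma measure_slice_UNIV: "U \<in> sets borel \<Longrightarrow> measure (slice U) UNIV = measure \<mu> U"
  using slice_UNIV[of U] by (simp add: measure_def)

lemma minimal_target_eq_slice: "minimal_target \<mu> \<nu> x = slice {x<..}"
  using least_target_slice[of "{x<..}"] by (intro minimal_target_eq_least_target) (auto simp: restr_def)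

text \<open>
  The earliest targets of the restrictions of \<open>\<mu>\<close> to open rays form a decreasing family below \<open>\<nu>\<close> with
  the masses of these rays, so a measure with these slices exists.  The masses yield the first
  marginal.  The second is dominated by \<open>\<nu>\<close>, as every slice is, and has the same mass.  The slice
  of \<open>{q<..}\<close> does not charge \<open>{..q}\<close>, because nothing moves to the left, and the sets
  \<open>{q<..} \<times> {..q}\<close> with rational \<open>q\<close> cover the region below the diagonal.
\<close>

lemma ex_optimal_coupling: "\<exists>P. is_optimal_coupling \<mu> \<nu> P"
proof -
  have "\<exists>P :: (real \<times> real) measure. prob_space P \<and> sets P = sets borel \<and>
      (\<forall>x. \<forall>B\<in>sets borel. emeasure P ({x<..} \<times> B) = emeasure (slice {x<..}) B)"
    by (rule ex_measure_with_upper_slices[OF mu nu])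
      (auto intro!: finite_slice slice_UNIV slice_le slice_mono)
  then obtain P where P: "prob_space P" and sets_P: "sets P = sets borel"
    and slices: "\<And>x B. B \<in> sets borel \<Longrightarrow> emeasure P ({x<..} \<times> B) = emeasure (slice {x<..}) B"
    by blast
  interpret P: prob_space P by fact
  have space_P: "space P = UNIV" using sets_eq_imp_space_eq[OF sets_P] by simp
  have fst_meas: "fst \<in> borel_measurable P" and snd_meas: "snd \<in> borel_measurable P"
    using sets_P by (simp_all cong: measurable_cong_sets add: borel_prod[symmetric])
  have fst_eq: "distr P borel fst = \<mu>"
  proof (rule cdf_unique)
    show D: "real_distribution (distr P borel fst)" using fst_meas by simp
    interpret D: real_distribution "distr P borel fst" by fact
    show "cdf (distr P borel fst) = cdf \<mu>"
    proof
      fix x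
      have "fst -` {x<..} \<inter> space P = {x<..} \<times> (UNIV :: real set)" by (auto simp: space_P)
      then have "emeasure (distr P borel fst) {x<..} = emeasure \<mu> {x<..}"
        using slices[of UNIV x] slice_UNIV[of "{x<..}"] by (simp add: emeasure_distr fst_meas)
      then show "cdf (distr P borel fst) x = cdf \<mu> x"
        using D.prob_greaterThan[of x] mu.prob_greaterThan[of x] by (simp add: measure_def)
    qed
  qed (rule mu)
  have rect: "{x<..} \<times> B \<in> sets P" if "B \<in> sets borel" for x :: real and B :: "real set"
    using that unfolding sets_P borel_prod[symmetric] by auto
  have snd_eq: "distr P borel snd = \<nu>"
  proof (rule real_distribution_eqI_le)
    show D: "real_distribution (distr P borel snd)" using snd_meas by simp
    interpret D: real_distribution "distr P borel snd" by fact
    have "emeasure (distr P borel snd) B \<le> emeasure \<nu> B" if B: "B \<in> sets borel" for B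
    proof -
      have "snd -` B \<inter> space P = (\<Union>n. {- real n<..} \<times> B)"
        by (auto simp: space_P) (metis minus_less_iff reals_Archimedean2)
      moreover have "emeasure P (\<Union>n. {- real n<..} \<times> B) = (SUP n. emeasure P ({- real n<..} \<times> B))"
        using rect[OF B] by (intro SUP_emeasure_incseq[symmetric]) (auto simp: incseq_def)
      moreover have "emeasure P ({- real n<..} \<times> B) \<le> emeasure \<nu> B" for n
        using slices[OF B] le_measureD3[OF slice_le] finite_borel_measure.M_is_borel[OF finite_slice]
        by simp
      ultimately show ?thesis
        using B snd_meas by (simp add: emeasure_distr SUP_least)
    qed
    then show "distr P borel snd \<le> \<nu>" by (simp add: le_measure)
  qed (rule nu)
  have "AE z in P. fst z \<le> snd z"
  proof -
    have "{q<..} \<times> {..q} \<in> null_sets P" for q :: real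
    proof -
      have "slice {q<..} \<in> st_targets (restr {q<..}) \<nu>"
        using least_target_slice[of "{q<..}"] by (simp add: least_target_def)
      then have "cdf (slice {q<..}) q \<le> cdf (restr {q<..}) q"
        by (simp add: st_targets_def st_le_def)
      also have "{q<..} \<inter> {..q} = {}" by auto
      then have "cdf (restr {q<..}) q = 0"
        using emeasure_restr[of "{q<..}" "{..q}"] by (simp add: cdf_def measure_def)
      finally have "measure (slice {q<..}) {..q} = 0"
        by (simp add: cdf_def measure_le_0_iff)
      then have "emeasure (slice {q<..}) {..q} = 0"
        using finite_borel_measure.axioms(1)[OF finite_slice, of "{q<..}"]
        by (simp add: finite_measure.emeasure_eq_measure)
      then show ?thesis using slices[of "{..q}" q] rect by (auto simp: null_sets_def)
    qed
    then have "(\<Union>q\<in>\<rat>. {q<..} \<times> {..q}) \<in> null_sets P"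
      by (intro null_sets_UN' countable_rat)
    moreover have "{z\<in>space P. \<not> fst z \<le> snd z} \<subseteq> (\<Union>q\<in>\<rat>. {q<..} \<times> {..q})"
    proof
      fix z assume "z \<in> {z\<in>space P. \<not> fst z \<le> snd z}"
      then have "snd z < fst z" by simp
      then obtain q where "q \<in> \<rat>" "snd z < q" "q < fst z"
        using Rats_dense_in_real by blast
      then show "z \<in> (\<Union>q\<in>\<rat>. {q<..} \<times> {..q})" by (cases z) auto
    qed
    ultimately show ?thesis by (rule AE_I')
  qed
  then have "is_optimal_coupling \<mu> \<nu> P"
    using P sets_P fst_eq snd_eq slices
    by (simp add: is_optimal_coupling_def directional_coupling_def minimal_target_eq_slice case_prod_beta)
  then show ?thesis ..
qed

text \<open>
  Both sides increase with \<open>U\<close>, and both change by at most the change of \<open>measure \<mu> U\<close>; they agree on open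
  rays, whose masses come arbitrarily close to that of \<open>U\<close>.
\<close>

lemma upper_slices_upward_closed:
  assumes P: "prob_space P" "sets P = sets borel" and fst: "distr P borel fst = \<mu>"
    and slices: "\<And>x B. B \<in> sets borel \<Longrightarrow> emeasure P ({x<..} \<times> B) = emeasure (slice {x<..}) B"
    and up: "\<And>a b. a \<in> U \<Longrightarrow> a \<le> b \<Longrightarrow> b \<in> U" and B: "B \<in> sets borel"
  shows "emeasure P (U \<times> B) = emeasure (slice U) B"
proof -
  interpret P: prob_space P by fact
  have U: "U \<in> sets borel" using up by (rule upward_closed_borel)
  have space_P: "space P = UNIV" using sets_eq_imp_space_eq[OF P(2)] by simp
  have fst_meas: "fst \<in> borel_measurable P"
    using P(2) by (simp cong: measurable_cong_sets add: borel_prod[symmetric])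
  have rect: "V \<times> C \<in> sets P" if "V \<in> sets borel" "C \<in> sets borel" for V C :: "real set"
    using that unfolding P(2) borel_prod[symmetric] by auto
  have P_fst: "measure P (V \<times> UNIV) = measure \<mu> V" if "V \<in> sets borel" for V
  proof -
    have "fst -` V \<inter> space P = V \<times> UNIV" by (auto simp: space_P)
    then show ?thesis using that fst_meas by (simp add: fst[symmetric] measure_distr)
  qed
  have P_gap: "measure P (V \<times> B) - measure P (V' \<times> B) \<in> {0..measure \<mu> V - measure \<mu> V'}"
    if V: "V \<in> sets borel" "V' \<in> sets borel" "V' \<subseteq> V" for V V'
  proof -
    have "measure P (V \<times> B) - measure P (V' \<times> B) = measure P ((V - V') \<times> B)"
      using V B by (subst P.finite_measure_Diff[symmetric]) (auto intro!: rect arg_cong[where f="measure P"])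
    moreover have "measure P ((V - V') \<times> B) \<le> measure P ((V - V') \<times> UNIV)"
      using V by (intro P.finite_measure_mono rect) auto
    moreover have "measure P ((V - V') \<times> UNIV) = measure \<mu> V - measure \<mu> V'"
      using V by (simp add: P_fst mu.finite_measure_Diff)
    ultimately show ?thesis by (simp add: measure_nonneg)
  qed
  have S_gap: "measure (slice V) B - measure (slice V') B \<in> {0..measure \<mu> V - measure \<mu> V'}"
    if V: "V \<in> sets borel" "V' \<in> sets borel" "V' \<subseteq> V" for V V'
    using finite_borel_measure_le_iff[OF finite_slice finite_slice, OF V(2,1)]
      finite_borel_measure_mass_gap[OF finite_slice finite_slice, OF V(2,1) _ B] slice_mono[OF V(2,1,3)] B
    by (simp add: measure_slice_UNIV V)
  have "\<bar>measure P (U \<times> B) - measure (slice U) B\<bar> \<le> 0"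
  proof (rule field_le_epsilon)
    fix e :: real assume "0 < e"
    have "\<exists>x. \<bar>measure \<mu> {x<..} - measure \<mu> U\<bar> < e"
      using up \<open>0 < e\<close> by (rule mu.upward_closed_approx)
    then obtain x where x: "\<bar>measure \<mu> {x<..} - measure \<mu> U\<bar> < e" ..
    have eq: "measure P ({x<..} \<times> B) = measure (slice {x<..}) B"
      using slices[OF B] by (simp add: measure_def)
    have "U \<subseteq> {x<..} \<or> {x<..} \<subseteq> U"
      using up by (metis greaterThan_iff less_imp_le not_le subsetI)
    then show "\<bar>measure P (U \<times> B) - measure (slice U) B\<bar> \<le> 0 + e"
    proof
      assume "U \<subseteq> {x<..}"
      then show ?thesis using P_gap[of "{x<..}" U] S_gap[of "{x<..}" U] U x eq by auto
    next
      assume "{x<..} \<subseteq> U"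
      then show ?thesis using P_gap[of U "{x<..}"] S_gap[of U "{x<..}"] U x eq by auto
    qed
  qed
  then show ?thesis
    using finite_borel_measure.axioms(1)[OF finite_slice[OF U]]
    by (simp add: P.emeasure_eq_measure finite_measure.emeasure_eq_measure)
qed

text \<open>
  The restriction of \<open>distr \<mu> borel \<phi>\<close> to \<open>{x<..}\<close> is the image of the restriction of \<open>\<mu>\<close> to the
  preimage of \<open>{x<..}\<close>.  At a jump of \<open>\<phi>\<close> this preimage can be a closed ray, and if \<open>\<phi>\<close> is bounded on one side it can
  be empty or the whole line; this is why the slices of the coupling are needed for all upward
  closed sets.
\<close>

lemma is_optimal_coupling_distr:
  fixes \<phi> :: "real \<Rightarrow> real"
  assumes phi: "strict_mono \<phi>"
    and P: "is_optimal_coupling \<mu> \<nu> P"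
  shows "is_optimal_coupling (distr \<mu> borel \<phi>) (distr \<nu> borel \<phi>) (distr P borel (map_prod \<phi> \<phi>))"
proof -
  note mono = strict_mono_mono[OF phi]
  note meas[measurable] = borel_measurable_mono[OF mono]
  have "prob_space P" and sets_P: "sets P = sets borel"
    and fst: "distr P borel fst = \<mu>" and snd: "distr P borel snd = \<nu>" and AE: "AE (x, y) in P. y \<ge> x"
    and slices: "\<And>x B. B \<in> sets borel \<Longrightarrow> emeasure P ({x<..} \<times> B) = emeasure (slice {x<..}) B"
    using P by (auto simp: is_optimal_coupling_def directional_coupling_def minimal_target_eq_slice)
  interpret P: prob_space P by fact
  have space_P: "space P = UNIV" using sets_eq_imp_space_eq[OF sets_P] by simp
  let ?\<Phi> = "map_prod \<phi> \<phi>"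
  have sets_P': "sets P = sets (borel \<Otimes>\<^sub>M borel)" unfolding sets_P borel_prod ..
  have \<Phi>[measurable]: "?\<Phi> \<in> P \<rightarrow>\<^sub>M borel"
    by (rule measurable_map_prod_borel[OF meas sets_P])
  have fst_P[measurable]: "fst \<in> P \<rightarrow>\<^sub>M borel" and snd_P[measurable]: "snd \<in> P \<rightarrow>\<^sub>M borel"
    unfolding measurable_cong_sets[OF sets_P' refl] by measurable
  have fst_b: "fst \<in> (borel :: (real \<times> real) measure) \<rightarrow>\<^sub>M borel"
    and snd_b: "snd \<in> (borel :: (real \<times> real) measure) \<rightarrow>\<^sub>M borel"
    unfolding borel_prod[symmetric] by measurable
  have "distr (distr P borel ?\<Phi>) borel fst = distr \<mu> borel \<phi>"
    unfolding fst[symmetric] by (subst (1 2) distr_distr) (auto simp: fst_b comp_def)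
  moreover have "distr (distr P borel ?\<Phi>) borel snd = distr \<nu> borel \<phi>"
    unfolding snd[symmetric] by (subst (1 2) distr_distr) (auto simp: snd_b comp_def)
  moreover have "AE z in distr P borel ?\<Phi>. fst z \<le> snd z"
  proof (subst AE_distr_iff[OF \<Phi>])
    show "{z \<in> space borel. fst z \<le> snd z} \<in> sets (borel :: (real \<times> real) measure)"
      unfolding borel_prod[symmetric] by measurable
    show "AE z in P. fst (?\<Phi> z) \<le> snd (?\<Phi> z)"
      using AE by eventually_elim (auto dest: monoD[OF mono])
  qed
  moreover have "emeasure (distr P borel ?\<Phi>) ({x<..} \<times> B) =
      emeasure (minimal_target (distr \<mu> borel \<phi>) (distr \<nu> borel \<phi>) x) B"
    if B: "B \<in> sets borel" for x B
  proof -
    define U where "U = \<phi> -` {x<..}"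
    have up: "\<And>a b. a \<in> U \<Longrightarrow> a \<le> b \<Longrightarrow> b \<in> U"
      using monoD[OF mono] by (auto simp: U_def intro: less_le_trans)
    then have U: "U \<in> sets borel" by (rule upward_closed_borel)
    have "density (distr \<mu> borel \<phi>) (indicator {x<..}) = distr (restr U) borel \<phi>"
    proof (rule measure_eqI)
      fix A assume "A \<in> sets (density (distr \<mu> borel \<phi>) (indicator {x<..}))"
      then have A: "A \<in> sets borel" by simp
      have "emeasure (density (distr \<mu> borel \<phi>) (indicator {x<..})) A =
          emeasure (distr \<mu> borel \<phi>) ({x<..} \<inter> A)"
        using A by (subst emeasure_density)
          (auto simp: indicator_inter_arith[symmetric] nn_integral_indicator)
      also have "\<dots> = emeasure \<mu> (U \<inter> \<phi> -` A)"
        using A by (simp add: emeasure_distr_borel U_def)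
      also have "\<dots> = emeasure (distr (restr U) borel \<phi>) A"
        using A U measurable_sets_borel[OF meas A]
        by (simp add: emeasure_distr_borel emeasure_restr finite_borel_measure.M_is_borel[OF finite_restr])
      finally show "emeasure (density (distr \<mu> borel \<phi>) (indicator {x<..})) A =
        emeasure (distr (restr U) borel \<phi>) A" .
    qed simp
    then have "minimal_target (distr \<mu> borel \<phi>) (distr \<nu> borel \<phi>) x = distr (slice U) borel \<phi>"
      using least_target_distr[OF finite_restr[OF U] nu.finite_borel_measure_M phi least_target_slice[OF U]]
      by (intro minimal_target_eq_least_target) auto
    then have "emeasure (minimal_target (distr \<mu> borel \<phi>) (distr \<nu> borel \<phi>) x) B =
        emeasure (slice U) (\<phi> -` B)"
      using B by (simp add: emeasure_distr_borel finite_borel_measure.M_is_borel[OF finite_slice[OF U]])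
    also have "\<dots> = emeasure P (U \<times> \<phi> -` B)"
      using upper_slices_upward_closed[OF \<open>prob_space P\<close> sets_P fst slices up] measurable_sets_borel[OF meas B]
      by simp
    also have "U \<times> \<phi> -` B = ?\<Phi> -` ({x<..} \<times> B) \<inter> space P"
      by (auto simp: U_def space_P)
    also have "emeasure P \<dots> = emeasure (distr P borel ?\<Phi>) ({x<..} \<times> B)"
      using B by (intro emeasure_distr[symmetric] \<Phi>) (auto simp: borel_prod[symmetric])
    finally show ?thesis by simp
  qed
  moreover have "prob_space (distr P borel ?\<Phi>)" by (rule P.prob_space_distr[OF \<Phi>])
  ultimately show ?thesis
    by (simp add: is_optimal_coupling_def directional_coupling_def case_prod_beta)
qed

end

text \<open>
  With a Borel left inverse \<open>\<psi>\<close> of \<open>\<phi>\<close>, a point is in the image exactly if \<open>\<phi> \<circ> \<psi>\<close> fixes its coordinates and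
  \<open>\<psi>\<close> sends it into \<open>A\<close>.
\<close>

lemma strict_mono_prod_image_borel:
  fixes \<phi> :: "real \<Rightarrow> real"
  assumes phi: "strict_mono \<phi>" and A: "A \<in> sets (borel :: (real \<times> real) measure)"
  shows "map_prod \<phi> \<phi> ` A \<in> sets borel"
proof -
  note [measurable] = borel_measurable_mono[OF strict_mono_mono[OF phi]]
  obtain \<psi> where [measurable]: "\<psi> \<in> borel_measurable borel" and inv: "\<And>x. \<psi> (\<phi> x) = x"
    using strict_mono_borel_left_inverse[OF phi] by blast
  have [measurable]: "A \<in> sets (borel \<Otimes>\<^sub>M borel)" using A unfolding borel_prod .
  have "map_prod \<phi> \<phi> ` A = {z \<in> space (borel \<Otimes>\<^sub>M borel). (\<psi> (fst z), \<psi> (snd z)) \<in> A \<and>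
      \<phi> (\<psi> (fst z)) = fst z \<and> \<phi> (\<psi> (snd z)) = snd z}"
  proof (intro equalityI subsetI)
    fix z assume "z \<in> {z \<in> space (borel \<Otimes>\<^sub>M borel). (\<psi> (fst z), \<psi> (snd z)) \<in> A \<and>
      \<phi> (\<psi> (fst z)) = fst z \<and> \<phi> (\<psi> (snd z)) = snd z}"
    then show "z \<in> map_prod \<phi> \<phi> ` A"
      by (intro image_eqI[of _ _ "(\<psi> (fst z), \<psi> (snd z))"]) (auto simp: prod_eq_iff)
  qed (auto simp: inv space_pair_measure)
  also have "\<dots> \<in> sets (borel \<Otimes>\<^sub>M borel)" by measurable
  finally show ?thesis by (simp only: borel_prod)
qed

theorem corollary2p3:
  fixes \<mu> \<nu> :: "real measure" and \<phi> :: "real \<Rightarrow> real"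
  assumes "real_distribution \<mu>" and "real_distribution \<nu>"
    and "\<mu> \<preceq>\<^sub>s\<^sub>t \<nu>"
    and "strict_mono \<phi>"
  shows "\<forall>A\<in>sets (borel :: (real \<times> real) measure).
    emeasure (P\<^sub>* \<mu> \<nu>) A =
    emeasure (P\<^sub>* (distr \<mu> borel \<phi>) (distr \<nu> borel \<phi>)) {(\<phi> x, \<phi> y) | x y. (x, y) \<in> A}"
proof
  fix A assume A: "A \<in> sets (borel :: (real \<times> real) measure)"
  interpret st_ordered_distributions \<mu> \<nu> using assms(1-3) by (rule st_ordered_distributions.intro)
  let ?\<Phi> = "map_prod \<phi> \<phi>"
  obtain P where P: "is_optimal_coupling \<mu> \<nu> P"
    using ex_optimal_coupling ..
  then have sets_P: "sets P = sets borel"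
    by (simp add: is_optimal_coupling_def directional_coupling_def)
  note P' = is_optimal_coupling_distr[OF \<open>strict_mono \<phi>\<close> P]
  have img: "{(\<phi> x, \<phi> y) | x y. (x, y) \<in> A} = ?\<Phi> ` A" by force
  have "inj ?\<Phi>"
    using strict_mono_imp_inj_on[OF \<open>strict_mono \<phi>\<close>] by (intro prod.inj_map)
  have "?\<Phi> \<in> P \<rightarrow>\<^sub>M borel"
    using measurable_map_prod_borel[OF borel_measurable_mono[OF strict_mono_mono[OF \<open>strict_mono \<phi>\<close>]] sets_P] .
  then have "emeasure (distr P borel ?\<Phi>) (?\<Phi> ` A) = emeasure P (?\<Phi> -` ?\<Phi> ` A \<inter> space P)"
    using strict_mono_prod_image_borel[OF \<open>strict_mono \<phi>\<close> A] by (intro emeasure_distr)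
  also have "?\<Phi> -` ?\<Phi> ` A \<inter> space P = A"
    using sets_eq_imp_space_eq[OF sets_P] \<open>inj ?\<Phi>\<close> by (simp add: inj_vimage_image_eq)
  finally show "emeasure (P\<^sub>* \<mu> \<nu>) A =
    emeasure (P\<^sub>* (distr \<mu> borel \<phi>) (distr \<nu> borel \<phi>)) {(\<phi> x, \<phi> y) | x y. (x, y) \<in> A}"
    by (simp add: img optimal_directional_coupling_eqI[OF P] optimal_directional_coupling_eqI[OF P'])
qed

end
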